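(* Let $E$ be a normed space, $F$ a (normed) $PL$-space, and let $E\otimes_pF$ be the projective tensor product of $E$ and the underlying normed space of $F$, regarded as a $PL$-space (see context). Then the canonical bilinear operator $\vartheta:E_{\max}\times F\to E\otimes_pF,\ (x,y)\mapsto x\otimes y$, considered between the respective $PL$-spaces, is $L$-contractive. Moreover, $\widehat\vartheta:E_{\max}\times F\to E\widehat\otimes_pF$, that is $\vartheta$ considered with $E\widehat\otimes_pF$ as its range, is also $L$-contractive.
   Context: All linear spaces are complex. $H$ is a fixed separable infinite-dimensional Hilbert space, $\mathcal{B}$ is the algebra of bounded operators on $H$ with the operator norm. For a linear space $E$, $HE:=H\otimes E$ (algebraic tensor product), with elementary tensors written $\xi x$; it is a left $\mathcal{B}$-module via $a\cdot(\xi x):=a(\xi)x$. A (normed) $PL$-space is a linear space $E$ together with a norm on $HE$ (the $PL$-norm) such that $\|a\cdot u\|\le\|a\|\|u\|$ for all $a\in\mathcal{B}$, $u\in HE$. Its underlying normed space is $E$ with $\|x\|:=\|\xi x\|$ for any $\xi\in H$, $\|\xi\|=1$ (independent of $\xi$). A $PL$-space is complete if its underlying normed space is complete. The completion of a $PL$-space $E$ is the complete $PL$-space $\overline{E}$ (the usual completion of the underlying normed space), where the norm on $H\overline{E}$ is induced by the natural embedding of $H\overline{E}$ into the completion $\overline{HE}$ of the normed space $HE$, $\xi x\mapsto\lim\xi x_n$ for $x_n\in E$, $x_n\to x$. $\otimes_p$ is the non-completed projective tensor product of normed spaces. For a normed space $E$, $E_{\max}$ is the $PL$-space $E$ with the norm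 on $HE$ equal to that of $H\otimes_pE$. For a normed space $E$ and a $PL$-space $F$, the $PL$-space $E\otimes_pF$ is $E\otimes F$ with the norm on $H(E\otimes F)$ for which the linear isomorphism $H(E\otimes F)\to E\otimes_p(HF)$, $\xi(x\otimes y)\mapsto x\otimes\xi y$, is isometric; its underlying normed space is the usual $E\otimes_pF$. $E\widehat\otimes_pF$ is the completion of this $PL$-space. Fix a unitary isomorphism $\iota$ from the Hilbert tensor product $H\widehat\otimes_{hil}H$ onto $H$, and put $\xi\diamondsuit\eta:=\iota(\xi\otimes\eta)$. A bilinear operator $\mathcal{R}:E\times F\to G$ has amplification $\mathcal{R}_\infty:HE\times HF\to HG$, well defined by $\mathcal{R}_\infty(\xi x,\eta y)=(\xi\diamondsuit\eta)\mathcal{R}(x,y)$; between $PL$-spaces, $\mathcal{R}$ is $L$-contractive if $\mathcal{R}_\infty$ is contractive. *)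

theory Defs
  imports "HOL-Analysis.Analysis" "HOL-Library.Poly_Mapping"
begin

section \<open>Complex linear spaces, normed spaces, Hilbert spaces\<close>

class scaleC =
  fixes scaleC :: "complex \<Rightarrow> 'a \<Rightarrow> 'a" (infixr \<open>*\<^sub>C\<close> 75)

class complex_vector = real_vector + scaleC +
  assumes scaleC_add_right: "c *\<^sub>C (x + y) = c *\<^sub>C x + c *\<^sub>C y"
    and scaleC_add_left: "(c + d) *\<^sub>C x = c *\<^sub>C x + d *\<^sub>C x"
    and scaleC_scaleC: "c *\<^sub>C d *\<^sub>C x = (c * d) *\<^sub>C x"
    and scaleC_one: "1 *\<^sub>C x = x"
    and scaleR_scaleC: "r *\<^sub>R x = complex_of_real r *\<^sub>C x"

global_interpretation complex_vector:
  vector_space "scaleC :: complex \<Rightarrow> 'a \<Rightarrow> 'a::complex_vector"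
  by unfold_locales (simp_all add: scaleC_add_right scaleC_add_left scaleC_scaleC scaleC_one)

abbreviation clinear :: "('a::complex_vector \<Rightarrow> 'b::complex_vector) \<Rightarrow> bool"
  where "clinear \<equiv> Vector_Spaces.linear scaleC scaleC"

definition cbilinear :: "('a::complex_vector \<Rightarrow> 'b::complex_vector \<Rightarrow> 'c::complex_vector) \<Rightarrow> bool"
  where "cbilinear B \<longleftrightarrow> (\<forall>x. clinear (B x)) \<and> (\<forall>y. clinear (\<lambda>x. B x y))"

class complex_normed_vector = complex_vector + real_normed_vector +
  assumes norm_scaleC: "norm (c *\<^sub>C x) = cmod c * norm x"

class cbanach = complex_normed_vector + complete_space

class complex_inner = complex_normed_vector +
  fixes cinner :: "'a \<Rightarrow> 'a \<Rightarrow> complex"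
  assumes cinner_commute: "cinner x y = cnj (cinner y x)"
    and cinner_add_left: "cinner (x + y) z = cinner x z + cinner y z"
    and cinner_scaleC_left: "cinner (c *\<^sub>C x) z = c * cinner x z"
    and cinner_self: "cinner x x = complex_of_real ((norm x)\<^sup>2)"

class chilbert_space = complex_inner + complete_space

definition infinite_cdim :: "'a::complex_vector itself \<Rightarrow> bool"
  where "infinite_cdim _ \<longleftrightarrow> \<not> (\<exists>S::'a set. finite S \<and> complex_vector.span S = UNIV)"

text \<open>For complex-linear operators, boundedness and the operator norm are those of the
  underlying real normed spaces.\<close>

definition bounded_clinear :: "('a::complex_normed_vector \<Rightarrow> 'b::complex_normed_vector) \<Rightarrow> bool"
  where "bounded_clinear a \<longleftrightarrow> clinear a \<and> bounded_linear a"

definition unitary_iso :: "('a::chilbert_space \<Rightarrow> 'b::chilbert_space) \<Rightarrow> bool"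
  where "unitary_iso f \<longleftrightarrow> clinear f \<and> bij f \<and> (\<forall>x y. cinner (f x) (f y) = cinner x y)"

text \<open>Spaces that carry several norms are handled with explicit norm functions.\<close>

definition is_cnorm :: "('a::complex_vector \<Rightarrow> real) \<Rightarrow> bool"
  where "is_cnorm N \<longleftrightarrow>
    (\<forall>x. 0 \<le> N x) \<and> (\<forall>x. N x = 0 \<longleftrightarrow> x = 0) \<and>
    (\<forall>x y. N (x + y) \<le> N x + N y) \<and> (\<forall>c x. N (c *\<^sub>C x) = cmod c * N x)"


section \<open>The algebraic tensor product\<close>

text \<open>The free linear space on \<open>'a \<times> 'b\<close> is \<open>('a \<times> 'b) \<Rightarrow>\<^sub>0 complex\<close>; it is divided by the
  subspace \<open>tensor_null\<close> spanned by the bilinearity relations.\<close>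

definition free_scale :: "complex \<Rightarrow> ('k \<Rightarrow>\<^sub>0 complex) \<Rightarrow> ('k \<Rightarrow>\<^sub>0 complex)"
  where "free_scale c = Poly_Mapping.map (\<lambda>z. c * z)"

abbreviation free_gen :: "'a \<Rightarrow> 'b \<Rightarrow> ('a \<times> 'b) \<Rightarrow>\<^sub>0 complex"
  where "free_gen x y \<equiv> Poly_Mapping.single (x, y) 1"

inductive_set tensor_null :: "(('a::complex_vector \<times> 'b::complex_vector) \<Rightarrow>\<^sub>0 complex) set" where
  null_zero: "0 \<in> tensor_null"
| null_add: "f \<in> tensor_null \<Longrightarrow> g \<in> tensor_null \<Longrightarrow> f + g \<in> tensor_null"
| null_scale: "f \<in> tensor_null \<Longrightarrow> free_scale c f \<in> tensor_null"
| null_add_left: "free_gen (x + x') y - free_gen x y - free_gen x' y \<in> tensor_null"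
| null_add_right: "free_gen x (y + y') - free_gen x y - free_gen x y' \<in> tensor_null"
| null_scale_left: "free_gen (c *\<^sub>C x) y - free_scale c (free_gen x y) \<in> tensor_null"
| null_scale_right: "free_gen x (c *\<^sub>C y) - free_scale c (free_gen x y) \<in> tensor_null"

lemma lookup_free_scale [simp]:
  "Poly_Mapping.lookup (free_scale c f) k = c * Poly_Mapping.lookup f k"
  unfolding free_scale_def by transfer (simp add: when_def)

lemma free_scale_add: "free_scale c (f + g) = free_scale c f + free_scale c g"
  by (rule poly_mapping_eqI) (simp add: lookup_add algebra_simps)

lemma free_scale_diff: "free_scale c (f - g) = free_scale c f - free_scale c g"
  by (rule poly_mapping_eqI) (simp add: lookup_minus algebra_simps)

lemma free_scale_add_left: "free_scale (c + d) f = free_scale c f + free_scale d f"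
  by (rule poly_mapping_eqI) (simp add: lookup_add algebra_simps)

lemma free_scale_scale: "free_scale c (free_scale d f) = free_scale (c * d) f"
  by (rule poly_mapping_eqI) simp

lemma free_scale_one: "free_scale 1 f = f"
  by (rule poly_mapping_eqI) simp

lemma free_scale_minus_one: "free_scale (-1) f = - f"
  by (rule poly_mapping_eqI) simp

lemma null_uminus: "f \<in> tensor_null \<Longrightarrow> - f \<in> tensor_null"
  using null_scale[of f "-1"] by (simp add: free_scale_minus_one)

quotient_type (overloaded) ('a, 'b) tensor =
    "('a::complex_vector \<times> 'b::complex_vector) \<Rightarrow>\<^sub>0 complex" /
    "\<lambda>f g. f - g \<in> tensor_null"
proof (rule equivpI)
  show "reflp (\<lambda>f g. f - g \<in> (tensor_null :: (('a \<times> 'b) \<Rightarrow>\<^sub>0 complex) set))"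
    by (rule reflpI) (simp add: null_zero)
  show "symp (\<lambda>f g. f - g \<in> (tensor_null :: (('a \<times> 'b) \<Rightarrow>\<^sub>0 complex) set))"
    by (rule sympI) (metis null_uminus minus_diff_eq)
  show "transp (\<lambda>f g. f - g \<in> (tensor_null :: (('a \<times> 'b) \<Rightarrow>\<^sub>0 complex) set))"
  proof (rule transpI)
    fix f g h :: "('a \<times> 'b) \<Rightarrow>\<^sub>0 complex"
    assume "f - g \<in> tensor_null" "g - h \<in> tensor_null"
    from null_add[OF this] show "f - h \<in> tensor_null" by simp
  qed
qed

instantiation tensor :: (complex_vector, complex_vector) complex_vector
begin

lift_definition zero_tensor :: "('a, 'b) tensor" is 0 .

lift_definition plus_tensor :: "('a, 'b) tensor \<Rightarrow> ('a, 'b) tensor \<Rightarrow> ('a, 'b) tensor" is "(+)"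
proof -
  fix f f' g g' :: "('a \<times> 'b) \<Rightarrow>\<^sub>0 complex"
  assume "f - f' \<in> tensor_null" "g - g' \<in> tensor_null"
  from null_add[OF this] show "f + g - (f' + g') \<in> tensor_null" by (simp add: algebra_simps)
qed

lift_definition uminus_tensor :: "('a, 'b) tensor \<Rightarrow> ('a, 'b) tensor" is "uminus"
proof -
  fix f f' :: "('a \<times> 'b) \<Rightarrow>\<^sub>0 complex"
  assume "f - f' \<in> tensor_null"
  from null_uminus[OF this] show "- f - (- f') \<in> tensor_null" by (simp add: algebra_simps)
qed

lift_definition minus_tensor :: "('a, 'b) tensor \<Rightarrow> ('a, 'b) tensor \<Rightarrow> ('a, 'b) tensor" is "(-)"
proof -
  fix f f' g g' :: "('a \<times> 'b) \<Rightarrow>\<^sub>0 complex"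
  assume "f - f' \<in> tensor_null" "g - g' \<in> tensor_null"
  from null_add[OF this(1) null_uminus[OF this(2)]]
  show "f - g - (f' - g') \<in> tensor_null" by (simp add: algebra_simps)
qed

lift_definition scaleC_tensor :: "complex \<Rightarrow> ('a, 'b) tensor \<Rightarrow> ('a, 'b) tensor" is free_scale
  by (simp add: null_scale flip: free_scale_diff)

definition scaleR_tensor :: "real \<Rightarrow> ('a, 'b) tensor \<Rightarrow> ('a, 'b) tensor"
  where "scaleR_tensor r u = complex_of_real r *\<^sub>C u"

instance
proof
  fix u v w :: "('a, 'b) tensor" and c d :: complex and r s :: real
  show add: "u + v + w = u + (v + w)"
    by transfer (simp add: null_zero algebra_simps)
  show "u + v = v + u" by transfer (simp add: null_zero algebra_simps)
  show "0 + u = u" by transfer (simp add: null_zero)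
  show "- u + u = 0" by transfer (simp add: null_zero)
  show "u - v = u + - v" by transfer (simp add: null_zero)
  show cr: "c *\<^sub>C (u + v) = c *\<^sub>C u + c *\<^sub>C v" for c :: complex and u v :: "('a, 'b) tensor"
    by transfer (simp add: null_zero free_scale_add)
  show cl: "(c + d) *\<^sub>C u = c *\<^sub>C u + d *\<^sub>C u" for c d :: complex and u :: "('a, 'b) tensor"
    by transfer (simp add: null_zero free_scale_add_left)
  show cs: "c *\<^sub>C d *\<^sub>C u = (c * d) *\<^sub>C u" for c d :: complex and u :: "('a, 'b) tensor"
    by transfer (simp add: null_zero free_scale_scale)
  show c1: "1 *\<^sub>C u = u" for u :: "('a, 'b) tensor"
    by transfer (simp add: null_zero free_scale_one)
  show "r *\<^sub>R u = complex_of_real r *\<^sub>C u" by (simp add: scaleR_tensor_def)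
  show "r *\<^sub>R (u + v) = r *\<^sub>R u + r *\<^sub>R v" by (simp add: scaleR_tensor_def cr)
  show "(r + s) *\<^sub>R u = r *\<^sub>R u + s *\<^sub>R u" by (simp add: scaleR_tensor_def cl)
  show "r *\<^sub>R s *\<^sub>R u = (r * s) *\<^sub>R u" by (simp add: scaleR_tensor_def cs)
  show "1 *\<^sub>R u = u" by (simp add: scaleR_tensor_def c1)
qed

end

lift_definition tprod :: "'a::complex_vector \<Rightarrow> 'b::complex_vector \<Rightarrow> ('a, 'b) tensor"
    (infixl \<open>\<otimes>\<close> 70)
  is free_gen .

text \<open>The linear extension of a bilinear operator, \<open>x \<otimes> y \<mapsto> B x y\<close>, evaluated on a
  representative in the free space.  It is independent of the representative only for bilinear
  \<open>B\<close> (see \<open>tensor_lift_unique\<close> below); it is a junk value otherwise.\<close>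

definition free_lift :: "('a \<Rightarrow> 'b \<Rightarrow> 'c::complex_vector) \<Rightarrow> (('a \<times> 'b) \<Rightarrow>\<^sub>0 complex) \<Rightarrow> 'c"
  where "free_lift B f =
    (\<Sum>k\<in>Poly_Mapping.keys f. Poly_Mapping.lookup f k *\<^sub>C B (fst k) (snd k))"

definition tensor_lift ::
    "('a::complex_vector \<Rightarrow> 'b::complex_vector \<Rightarrow> 'c::complex_vector) \<Rightarrow> ('a, 'b) tensor \<Rightarrow> 'c"
  where "tensor_lift B u = free_lift B (rep_tensor u)"

lemma free_lift_superset:
  assumes "finite S" "Poly_Mapping.keys f \<subseteq> S"
  shows "free_lift B f = (\<Sum>k\<in>S. Poly_Mapping.lookup f k *\<^sub>C B (fst k) (snd k))"
  unfolding free_lift_def using assms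
  by (intro sum.mono_neutral_left) (auto simp: in_keys_iff)

lemma free_lift_add: "free_lift B (f + g) = free_lift B f + free_lift B g"
proof -
  let ?S = "Poly_Mapping.keys f \<union> Poly_Mapping.keys g"
  have "free_lift B h = (\<Sum>k\<in>?S. Poly_Mapping.lookup h k *\<^sub>C B (fst k) (snd k))"
    if "Poly_Mapping.keys h \<subseteq> ?S" for h
    using that by (intro free_lift_superset) auto
  moreover have "Poly_Mapping.keys (f + g) \<subseteq> ?S" by (rule keys_add)
  ultimately show ?thesis by (simp add: lookup_add scaleC_add_left sum.distrib)
qed

lemma free_lift_scale: "free_lift B (free_scale c f) = c *\<^sub>C free_lift B f"
proof -
  have "Poly_Mapping.keys (free_scale c f) \<subseteq> Poly_Mapping.keys f"
    by (auto simp: in_keys_iff)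
  then show ?thesis
    using free_lift_superset[of "Poly_Mapping.keys f" "free_scale c f" B]
    by (simp add: free_lift_def complex_vector.scale_sum_right scaleC_scaleC)
qed

lemma free_lift_diff: "free_lift B (f - g) = free_lift B f - free_lift B g"
  using free_lift_add[of B "f - g" g] by simp

lemma free_lift_gen: "free_lift B (free_gen x y) = B x y"
  by (simp add: free_lift_def complex_vector.scale_one)

lemma clinear_simps:
  assumes "clinear f"
  shows "f (x + y) = f x + f y" "f (c *\<^sub>C x) = c *\<^sub>C f x" "f (x - y) = f x - f y" "f 0 = 0"
proof -
  interpret Vector_Spaces.linear scaleC scaleC f by (fact assms)
  show "f (x + y) = f x + f y" by (fact add)
  show "f (c *\<^sub>C x) = c *\<^sub>C f x" by (fact scale)
  show "f (x - y) = f x - f y" by (fact diff)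
  show "f 0 = 0" by (fact zero)
qed

lemma clinearI:
  assumes "\<And>x y. f (x + y) = f x + f y" "\<And>c x. f (c *\<^sub>C x) = c *\<^sub>C f x"
  shows "clinear f"
  by unfold_locales (use assms in simp_all)

lemma cbilinear_simps:
  assumes "cbilinear B"
  shows "B (x + x') y = B x y + B x' y" "B x (y + y') = B x y + B x y'"
    "B (c *\<^sub>C x) y = c *\<^sub>C B x y" "B x (c *\<^sub>C y) = c *\<^sub>C B x y"
proof -
  have r: "clinear (B x)" and l: "clinear (\<lambda>x. B x y)" for x y
    using assms unfolding cbilinear_def by auto
  show "B (x + x') y = B x y + B x' y" "B x (y + y') = B x y + B x y'"
    "B (c *\<^sub>C x) y = c *\<^sub>C B x y" "B x (c *\<^sub>C y) = c *\<^sub>C B x y"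
    using clinear_simps(1,2)[OF r] clinear_simps(1,2)[OF l] by auto
qed

lemma free_lift_null:
  assumes "cbilinear B" "f \<in> tensor_null"
  shows "free_lift B f = 0"
  using assms(2)
proof induction
  case null_zero
  show ?case by (simp add: free_lift_def)
qed (simp_all add: free_lift_add free_lift_scale free_lift_diff free_lift_gen
       cbilinear_simps[OF assms(1)])

lemma tensor_lift_abs:
  assumes "cbilinear B"
  shows "tensor_lift B (abs_tensor f) = free_lift B f"
proof -
  have "rep_tensor (abs_tensor f) - f \<in> tensor_null"
    by (simp add: Quotient3_rep_abs[OF Quotient3_tensor] null_zero)
  from free_lift_null[OF assms this] show ?thesis by (simp add: free_lift_diff tensor_lift_def)
qed

lemma tensor_abs_cases: obtains f where "u = abs_tensor f"
  using Quotient3_abs_rep[OF Quotient3_tensor, of u] by metis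

lemma cbilinear_tprod: "cbilinear (\<otimes>)"
proof -
  have "abs_tensor f = abs_tensor g" if "f - g \<in> tensor_null"
    for f g :: "('a \<times> 'b) \<Rightarrow>\<^sub>0 complex"
    using that by (simp add: tensor.abs_eq_iff)
  then have "(x + x') \<otimes> y = x \<otimes> y + x' \<otimes> y" "x \<otimes> (y + y') = x \<otimes> y + x \<otimes> y'"
    "(c *\<^sub>C x) \<otimes> y = c *\<^sub>C (x \<otimes> y)" "x \<otimes> (c *\<^sub>C y) = c *\<^sub>C (x \<otimes> y)"
    for x x' :: 'a and y y' :: 'b and c
    by (simp_all add: tprod.abs_eq plus_tensor.abs_eq scaleC_tensor.abs_eq
        null_add_left null_add_right null_scale_left null_scale_right diff_diff_eq[symmetric])
  then show ?thesis unfolding cbilinear_def by (auto intro!: clinearI)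
qed

text \<open>The universal property.\<close>

lemma tensor_lift_tprod: "cbilinear B \<Longrightarrow> tensor_lift B (x \<otimes> y) = B x y"
  by (simp add: tprod.abs_eq tensor_lift_abs free_lift_gen)

lemma clinear_tensor_lift:
  assumes "cbilinear B"
  shows "clinear (tensor_lift B)"
proof (rule clinearI)
  fix u v :: "('a, 'b) tensor" and c
  obtain f g where "u = abs_tensor f" "v = abs_tensor g" by (metis tensor_abs_cases)
  then show "tensor_lift B (u + v) = tensor_lift B u + tensor_lift B v"
    "tensor_lift B (c *\<^sub>C u) = c *\<^sub>C tensor_lift B u"
    by (simp_all add: plus_tensor.abs_eq scaleC_tensor.abs_eq tensor_lift_abs[OF assms]
        free_lift_add free_lift_scale)
qed

lemma free_induct:
  assumes "P 0" "\<And>c x y f. P f \<Longrightarrow> P (free_scale c (free_gen x y) + f)"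
  shows "P f"
proof (induction f rule: update_induct)
  case const
  then show ?case by (simp add: assms(1))
next
  case (update f k c)
  have "Poly_Mapping.update k c f = free_scale c (free_gen (fst k) (snd k)) + f"
    using update by (intro poly_mapping_eqI)
      (auto simp: lookup_update lookup_add lookup_single when_def in_keys_iff)
  then show ?case using assms(2)[OF update(3), of c "fst k" "snd k"] by simp
qed

lemma tensor_induct [case_names zero add]:
  assumes "P 0" "\<And>x y u. P u \<Longrightarrow> P (x \<otimes> y + u)"
  shows "P u"
proof -
  have "P (abs_tensor f)" for f
  proof (induction f rule: free_induct)
    case 1
    show ?case using assms(1) by (simp add: zero_tensor_def)
  next
    case (2 c x y f)
    have "abs_tensor (free_scale c (free_gen x y) + f) = (c *\<^sub>C x) \<otimes> y + abs_tensor f"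
      by (simp add: plus_tensor.abs_eq[symmetric] scaleC_tensor.abs_eq[symmetric]
          tprod.abs_eq[symmetric] cbilinear_simps[OF cbilinear_tprod])
    then show ?case using assms(2)[OF 2] by simp
  qed
  then show ?thesis by (metis tensor_abs_cases)
qed

lemma tensor_lift_unique:
  assumes "cbilinear B" "clinear L" "\<And>x y. L (x \<otimes> y) = B x y"
  shows "L = tensor_lift B"
proof
  fix u show "L u = tensor_lift B u"
    by (induction u rule: tensor_induct)
      (simp_all add: clinear_simps[OF assms(2)] clinear_simps[OF clinear_tensor_lift[OF assms(1)]]
        assms(3) tensor_lift_tprod[OF assms(1)])
qed


section \<open>Projective norms and completions\<close>

definition proj_norm ::
    "('a::complex_vector \<Rightarrow> real) \<Rightarrow> ('b::complex_vector \<Rightarrow> real) \<Rightarrow> ('a, 'b) tensor \<Rightarrow> real"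
  where "proj_norm N M u =
    Inf {(\<Sum>i<n. N (x i) * M (y i)) |(n::nat) x y. u = (\<Sum>i<n. x i \<otimes> y i)}"

text \<open>A completion of \<open>('a, N)\<close> is a Banach space together with an isometric linear map with
  dense range; this determines it up to isometric isomorphism over \<open>'a\<close>.\<close>

definition completion_map :: "('a::complex_vector \<Rightarrow> real) \<Rightarrow> ('a \<Rightarrow> 'c::cbanach) \<Rightarrow> bool"
  where "completion_map N j \<longleftrightarrow>
    clinear j \<and> (\<forall>x. norm (j x) = N x) \<and> closure (range j) = UNIV"

text \<open>Likewise, \<open>t\<close> exhibits the Hilbert space \<open>'k\<close> as the Hilbert tensor product of \<open>'a\<close> and \<open>'b\<close>,
  that is, the completion of the algebraic tensor product for the inner product
  determined by the displayed equation.\<close>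

definition hilbert_tensor_map ::
    "(('a::chilbert_space, 'b::chilbert_space) tensor \<Rightarrow> 'k::chilbert_space) \<Rightarrow> bool"
  where "hilbert_tensor_map t \<longleftrightarrow>
    clinear t \<and>
    (\<forall>x y x' y'. cinner (t (x \<otimes> y)) (t (x' \<otimes> y')) = cinner x x' * cinner y y') \<and>
    closure (range t) = UNIV"


section \<open>PL-spaces\<close>

text \<open>In \<open>('h, 'e) tensor\<close>, the type \<open>'h\<close> is the fixed Hilbert space.  A PL-space is a linear
  space \<open>'e\<close> together with a PL-norm on \<open>('h, 'e) tensor\<close>.\<close>

definition op_act :: "('h::chilbert_space \<Rightarrow> 'h) \<Rightarrow> ('h, 'e::complex_vector) tensor \<Rightarrow> ('h, 'e) tensor"
  where "op_act a = tensor_lift (\<lambda>\<xi> x. a \<xi> \<otimes> x)"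

definition PL_norm :: "(('h::chilbert_space, 'e::complex_vector) tensor \<Rightarrow> real) \<Rightarrow> bool"
  where "PL_norm p \<longleftrightarrow>
    is_cnorm p \<and> (\<forall>a u. bounded_clinear a \<longrightarrow> p (op_act a u) \<le> onorm a * p u)"

text \<open>For a PL-norm the choice of the unit vector is irrelevant.\<close>

definition underlying_norm :: "(('h::chilbert_space, 'e::complex_vector) tensor \<Rightarrow> real) \<Rightarrow> 'e \<Rightarrow> real"
  where "underlying_norm p x = p ((SOME \<xi>. norm \<xi> = 1) \<otimes> x)"

text \<open>The PL-norm of \<open>E\<^sub>m\<^sub>a\<^sub>x\<close>, for a normed space \<open>'e\<close>.\<close>

definition max_PL_norm :: "('h::chilbert_space, 'e::complex_normed_vector) tensor \<Rightarrow> real"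
  where "max_PL_norm = proj_norm norm norm"

text \<open>The PL-norm of \<open>E \<otimes>\<^sub>p F\<close> is pulled back along
  \<open>\<xi> \<otimes> (x \<otimes> y) \<mapsto> x \<otimes> (\<xi> \<otimes> y)\<close>.\<close>

definition tensor_swap ::
    "('h::complex_vector, ('e::complex_vector, 'f::complex_vector) tensor) tensor
      \<Rightarrow> ('e, ('h, 'f) tensor) tensor"
  where "tensor_swap = tensor_lift (\<lambda>\<xi>. tensor_lift (\<lambda>x y. x \<otimes> (\<xi> \<otimes> y)))"

definition proj_PL_norm ::
    "(('h::chilbert_space, 'f::complex_vector) tensor \<Rightarrow> real)
      \<Rightarrow> ('h, ('e::complex_normed_vector, 'f) tensor) tensor \<Rightarrow> real"
  where "proj_PL_norm p u = proj_norm norm p (tensor_swap u)"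

text \<open>The completion of the PL-space \<open>('e, p)\<close> is built from a completion \<open>j\<close> of its underlying
  normed space and a completion \<open>J\<close> of the normed space \<open>('h, 'e) tensor\<close>.\<close>

definition PL_completion_maps ::
    "(('h::chilbert_space, 'e::complex_vector) tensor \<Rightarrow> real)
      \<Rightarrow> ('e \<Rightarrow> 'c::cbanach) \<Rightarrow> (('h, 'e) tensor \<Rightarrow> 'd::cbanach) \<Rightarrow> bool"
  where "PL_completion_maps p j J \<longleftrightarrow>
    completion_map (underlying_norm p) j \<and> completion_map p J"

text \<open>The embedding of \<open>H\<otimes>'c\<close> into the completion of \<open>H\<otimes>'e\<close>:
  \<open>\<xi> \<otimes> x \<mapsto> lim J (\<xi> \<otimes> xs n)\<close> for any sequence with \<open>j (xs n) \<longlonglongrightarrow> x\<close>.  For the completion maps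
  of a PL-space the limit exists, does not depend on \<open>xs\<close> and is bilinear in \<open>\<xi>\<close> and \<open>x\<close>.\<close>

definition natural_embedding ::
    "('e::complex_vector \<Rightarrow> 'c::cbanach) \<Rightarrow> (('h::chilbert_space, 'e) tensor \<Rightarrow> 'd::cbanach)
      \<Rightarrow> ('h, 'c) tensor \<Rightarrow> 'd"
  where "natural_embedding j J = tensor_lift (\<lambda>\<xi> x.
    THE z. \<forall>xs. (\<lambda>n. j (xs n)) \<longlonglongrightarrow> x \<longrightarrow> (\<lambda>n. J (\<xi> \<otimes> xs n)) \<longlonglongrightarrow> z)"

definition completion_PL_norm ::
    "('e::complex_vector \<Rightarrow> 'c::cbanach) \<Rightarrow> (('h::chilbert_space, 'e) tensor \<Rightarrow> 'd::cbanach)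
      \<Rightarrow> ('h, 'c) tensor \<Rightarrow> real"
  where "completion_PL_norm j J u = norm (natural_embedding j J u)"

definition diamond ::
    "(('h::chilbert_space, 'h) tensor \<Rightarrow> 'k::chilbert_space) \<Rightarrow> ('k \<Rightarrow> 'h) \<Rightarrow> 'h \<Rightarrow> 'h \<Rightarrow> 'h"
  where "diamond t \<iota> \<xi> \<eta> = \<iota> (t (\<xi> \<otimes> \<eta>))"

text \<open>The bilinear operator with \<open>(\<xi> \<otimes> x, \<eta> \<otimes> y) \<mapsto> dia \<xi> \<eta> \<otimes> R x y\<close>.\<close>

definition amplification ::
    "('h::chilbert_space \<Rightarrow> 'h \<Rightarrow> 'h)
      \<Rightarrow> ('e::complex_vector \<Rightarrow> 'f::complex_vector \<Rightarrow> 'g::complex_vector)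
      \<Rightarrow> ('h, 'e) tensor \<Rightarrow> ('h, 'f) tensor \<Rightarrow> ('h, 'g) tensor"
  where "amplification dia R u v =
    tensor_lift (\<lambda>\<xi> x. tensor_lift (\<lambda>\<eta> y. dia \<xi> \<eta> \<otimes> R x y) v) u"

definition L_contractive ::
    "('h::chilbert_space \<Rightarrow> 'h \<Rightarrow> 'h)
      \<Rightarrow> (('h, 'e::complex_vector) tensor \<Rightarrow> real)
      \<Rightarrow> (('h, 'f::complex_vector) tensor \<Rightarrow> real)
      \<Rightarrow> (('h, 'g::complex_vector) tensor \<Rightarrow> real)
      \<Rightarrow> ('e \<Rightarrow> 'f \<Rightarrow> 'g) \<Rightarrow> bool"
  where "L_contractive dia p q r R \<longleftrightarrow>
    cbilinear R \<and> (\<forall>u v. r (amplification dia R u v) \<le> p u * q v)"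

end

theory Submission
  imports Defs
begin

(* The amplification sends (\<Sum>i. \<xi>_i x_i, v) to the element of H(E \<otimes> F) that corresponds to
   \<Sum>i. x_i \<otimes> T_i v in E \<otimes> HF, where T_i = \<xi>_i \<diamondsuit> (-) is an operator on H of norm at most |\<xi>_i|.
   Hence the projective norm of the image is at most (\<Sum>i. |x_i| |\<xi>_i|) |v|, and taking the infimum
   over the representations of u gives |u| |v|.  On elements of H(E \<otimes> F) the norm of the completed
   PL-space is the original one, as the rank one operators (-, e) \<xi> bound |\<xi> w| by |\<xi>| |w| and so
   make the natural embedding well defined. *)

section \<open>Linear algebra in the algebraic tensor product\<close>

lemma clinear_sum: "clinear f \<Longrightarrow> f (sum g A) = (\<Sum>i\<in>A. f (g i))"
  by (induction A rule: infinite_finite_induct) (simp_all add: clinear_simps)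

lemma cbilinearI:
  assumes "\<And>x x' y. B (x + x') y = B x y + B x' y" "\<And>c x y. B (c *\<^sub>C x) y = c *\<^sub>C B x y"
    and "\<And>x y y'. B x (y + y') = B x y + B x y'" "\<And>c x y. B x (c *\<^sub>C y) = c *\<^sub>C B x y"
  shows "cbilinear B"
  unfolding cbilinear_def by (auto intro!: clinearI assms)

lemmas tprod_simps = cbilinear_simps[OF cbilinear_tprod]

lemma tprod_zero_right [simp]: "x \<otimes> 0 = 0"
  using cbilinear_tprod clinear_simps(4) unfolding cbilinear_def by blast

lemma tprod_diff_right: "x \<otimes> (y - z) = x \<otimes> y - x \<otimes> z"
  using cbilinear_tprod clinear_simps(3) unfolding cbilinear_def by blast

text \<open>\<open>tensor_lift\<close> evaluates a finite sum at one fixed representative of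
  \<open>u\<close>, and that sum is additive in the function lifted. This gives linearity of nested
  lifts in the parameters of the inner lift.\<close>

lemma tensor_lift_fun_add:
  "tensor_lift (\<lambda>x y. B x y + C x y) u = tensor_lift B u + tensor_lift C u"
  by (simp add: tensor_lift_def free_lift_def scaleC_add_right sum.distrib)

lemma tensor_lift_fun_scale: "tensor_lift (\<lambda>x y. c *\<^sub>C B x y) u = c *\<^sub>C tensor_lift B u"
  by (simp add: tensor_lift_def free_lift_def complex_vector.scale_sum_right scaleC_scaleC
      mult.commute)

text \<open>Ensures that the infimum in \<open>proj_norm\<close> is taken over a nonempty
  set.\<close>

lemma tensor_rep: obtains n :: nat and x y where "u = (\<Sum>i<n. x i \<otimes> y i)"
proof -
  have "\<exists>(n::nat) x y. u = (\<Sum>i<n. x i \<otimes> y i)"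
  proof (induction u rule: tensor_induct)
    case zero
    show ?case by (rule exI[of _ 0]) simp
  next
    case (add a b u)
    then obtain n :: nat and x y where u: "u = (\<Sum>i<n. x i \<otimes> y i)" by blast
    \<comment> \<open>The new elementary tensor is placed at index \<open>n\<close>, beyond those
      used for \<open>u\<close>.\<close>
    have "a \<otimes> b + u = (\<Sum>i<Suc n. (x(n := a)) i \<otimes> (y(n := b)) i)"
      by (simp add: u add.commute)
    then show ?case by blast
  qed
  then show thesis using that by blast
qed


section \<open>Projective norms\<close>

text \<open>For nonnegative \<open>N\<close> and \<open>M\<close> the set of sums is bounded below
  by 0, so its infimum is a genuine lower bound.\<close>

lemma proj_norm_le_sum:
  assumes "\<And>x. 0 \<le> N x" "\<And>y. 0 \<le> M y"
  shows "proj_norm N M (\<Sum>i<n::nat. x i \<otimes> y i) \<le> (\<Sum>i<n. N (x i) * M (y i))"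
  unfolding proj_norm_def
proof (rule cInf_lower)
  show "bdd_below {(\<Sum>i<m. N (x' i) * M (y' i)) |(m::nat) x' y'.
      (\<Sum>i<n. x i \<otimes> y i) = (\<Sum>i<m. x' i \<otimes> y' i)}"
    using assms by (auto intro!: bdd_belowI[of _ 0] sum_nonneg)
qed blast

text \<open>Passes to the infimum over all representations in an estimate that carries a constant
  factor \<open>K\<close>. Division by \<open>K\<close> reduces this to the greatest lower bound
  property.\<close>

lemma le_proj_norm_mult:
  assumes "0 \<le> K"
    and le: "\<And>(n::nat) x y. u = (\<Sum>i<n. x i \<otimes> y i) \<Longrightarrow> a \<le> (\<Sum>i<n. N (x i) * M (y i)) * K"
  shows "a \<le> proj_norm N M u * K"
proof (cases "K = 0")
  \<comment> \<open>Division is impossible here, but a single representation already yields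
    \<open>a \<le> 0\<close>.\<close>
  case True
  obtain n :: nat and x y where "u = (\<Sum>i<n. x i \<otimes> y i)" by (rule tensor_rep)
  from le[OF this] True show ?thesis by simp
next
  case False
  with assms(1) have K: "K > 0" by simp
  have "a / K \<le> proj_norm N M u"
    unfolding proj_norm_def
  proof (rule cInf_greatest)
    obtain n :: nat and x y where "u = (\<Sum>i<n. x i \<otimes> y i)" by (rule tensor_rep)
    then show "{(\<Sum>i<n. N (x i) * M (y i)) |(n::nat) x y. u = (\<Sum>i<n. x i \<otimes> y i)} \<noteq> {}"
      by blast
  qed (use K le in \<open>auto simp: pos_divide_le_eq\<close>)
  with K show ?thesis by (simp add: pos_divide_le_eq)
qed


section \<open>Operators on the Hilbert space and PL-norms\<close>

lemma bounded_clinearI: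
  assumes "clinear f" "\<And>x. norm (f x) \<le> K * norm x"
  shows "bounded_clinear f"
  unfolding bounded_clinear_def
proof
  show "bounded_linear f"
    by (rule bounded_linear_intro[where K = K])
      (use assms in \<open>simp_all add: clinear_simps scaleR_scaleC mult.commute\<close>)
qed fact

lemma cbilinear_op_act:
  assumes "clinear a"
  shows "cbilinear (\<lambda>\<xi> x. a \<xi> \<otimes> x)"
  by (rule cbilinearI) (simp_all add: clinear_simps[OF assms] tprod_simps)

lemma op_act_tprod: "clinear a \<Longrightarrow> op_act a (\<xi> \<otimes> x) = a \<xi> \<otimes> x"
  by (simp add: op_act_def tensor_lift_tprod cbilinear_op_act)

lemma clinear_op_act: "clinear a \<Longrightarrow> clinear (op_act a)"
  unfolding op_act_def by (intro clinear_tensor_lift cbilinear_op_act)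

lemma PL_norm_nonneg: "PL_norm p \<Longrightarrow> 0 \<le> p u"
  by (simp add: PL_norm_def is_cnorm_def)

text \<open>Replaces the operator norm by any explicit bound \<open>K\<close>, since
  \<open>onorm a \<le> K\<close>.\<close>

lemma PL_norm_op_act_le:
  assumes "PL_norm p" "clinear a" "0 \<le> K" "\<And>\<xi>. norm (a \<xi>) \<le> K * norm \<xi>"
  shows "p (op_act a u) \<le> K * p u"
proof -
  have "bounded_clinear a" using assms by (intro bounded_clinearI)
  then have "p (op_act a u) \<le> onorm a * p u" using assms(1) by (simp add: PL_norm_def)
  also have "\<dots> \<le> K * p u"
    using assms by (intro mult_right_mono onorm_bound PL_norm_nonneg[OF assms(1)])
  finally show ?thesis .
qed

section \<open>Rank one operators and unit vectors\<close>

lemma cinner_add_right: "cinner x (y + z) = cinner x y + cinner x z"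
  by (metis cinner_add_left cinner_commute complex_cnj_add)

lemma cinner_scaleC_right: "cinner x (c *\<^sub>C y) = cnj c * cinner x y"
  by (metis cinner_scaleC_left cinner_commute complex_cnj_mult)

lemma clinear_rank_one: "clinear (\<lambda>\<eta>. cinner \<eta> e *\<^sub>C \<xi>)"
  by (rule clinearI)
    (simp_all add: cinner_add_left cinner_scaleC_left scaleC_add_left scaleC_scaleC)

text \<open>Cauchy-Schwarz against a unit vector. With \<open>c = - cinner x e\<close>, the vector
  \<open>x + c *\<^sub>C e\<close> is the component of \<open>x\<close> orthogonal to
  \<open>e\<close>, and its squared norm is that of \<open>x\<close> minus the square of
  \<open>cmod c\<close>.\<close>

lemma cmod_cinner_unit_le:
  assumes "norm e = 1"
  shows "cmod (cinner x e) \<le> norm x"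
proof -
  define c where "c = - cinner x e"
  have xe: "cinner x e = - c" by (simp add: c_def)
  have ex: "cinner e x = - cnj c" unfolding c_def by (subst cinner_commute) simp
  have ee: "cinner e e = 1" using assms by (simp add: cinner_self)
  have "complex_of_real ((norm (x + c *\<^sub>C e))\<^sup>2) = complex_of_real ((norm x)\<^sup>2) - c * cnj c"
    unfolding cinner_self[symmetric]
    by (simp add: cinner_add_left cinner_add_right cinner_scaleC_left cinner_scaleC_right
        xe ex ee)
  also have "\<dots> = complex_of_real ((norm x)\<^sup>2 - (cmod c)\<^sup>2)"
    by (simp add: complex_norm_square[symmetric])
  finally have "(norm (x + c *\<^sub>C e))\<^sup>2 = (norm x)\<^sup>2 - (cmod c)\<^sup>2"
    by (simp only: of_real_eq_iff)
  then have "(cmod c)\<^sup>2 \<le> (norm x)\<^sup>2" by (smt (verit) zero_le_power2)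
  then show ?thesis unfolding c_def by (simp add: power2_le_iff_abs_le)
qed

text \<open>A zero space would be spanned by the empty set. The unit vector makes the choice in
  \<open>underlying_norm\<close> meaningful.\<close>

lemma exists_unit_vector:
  assumes "infinite_cdim TYPE('h::complex_normed_vector)"
  shows "\<exists>e::'h. norm e = 1"
proof -
  have "\<exists>x::'h. x \<noteq> 0"
  proof (rule ccontr)
    assume "\<not> (\<exists>x::'h. x \<noteq> 0)"
    then have "complex_vector.span ({}::'h set) = UNIV" by auto
    with assms show False unfolding infinite_cdim_def by blast
  qed
  then obtain x :: 'h where "x \<noteq> 0" by blast
  then have "norm ((1 / norm x) *\<^sub>R x) = 1" by simp
  then show ?thesis by blast
qed


section \<open>The PL-norm of the projective tensor product\<close>

lemma cbilinear_swap_inner: "cbilinear (\<lambda>x y. x \<otimes> (\<xi> \<otimes> y))"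
  by (rule cbilinearI) (simp_all add: tprod_simps)

lemma cbilinear_swap: "cbilinear (\<lambda>\<xi>. tensor_lift (\<lambda>x y. x \<otimes> (\<xi> \<otimes> y)))"
  by (rule cbilinearI)
    (simp_all add: clinear_simps[OF clinear_tensor_lift[OF cbilinear_swap_inner]] tprod_simps
      tensor_lift_fun_add tensor_lift_fun_scale)

lemma clinear_tensor_swap: "clinear tensor_swap"
  unfolding tensor_swap_def by (rule clinear_tensor_lift[OF cbilinear_swap])

lemma tensor_swap_tprod: "tensor_swap (\<xi> \<otimes> (x \<otimes> y)) = x \<otimes> (\<xi> \<otimes> y)"
  by (simp add: tensor_swap_def tensor_lift_tprod[OF cbilinear_swap]
      tensor_lift_tprod[OF cbilinear_swap_inner])

lemma cbilinear_tprod_op_act: "clinear a \<Longrightarrow> cbilinear (\<lambda>x w. x \<otimes> op_act a w)"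
  by (rule cbilinearI) (simp_all add: tprod_simps clinear_simps[OF clinear_op_act])

text \<open>Under the swap the action of \<open>a\<close> becomes the identity on E tensored with
  the action on HF. Both sides are linear, so elementary tensors suffice, first for \<open>u\<close>
  and then for its right factor.\<close>

lemma tensor_swap_op_act:
  assumes a: "clinear a"
  shows "tensor_swap (op_act a u) = tensor_lift (\<lambda>x w. x \<otimes> op_act a w) (tensor_swap u)"
proof -
  note bil = cbilinear_tprod_op_act[OF a]
  note lin = clinear_simps[OF clinear_tensor_swap] clinear_simps[OF clinear_op_act[OF a]]
    clinear_simps[OF clinear_tensor_lift[OF bil]]
  have gen: "tensor_swap (op_act a (\<xi> \<otimes> w)) =
      tensor_lift (\<lambda>x w. x \<otimes> op_act a w) (tensor_swap (\<xi> \<otimes> w))" for \<xi> w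
    by (induction w rule: tensor_induct)
      (simp_all add: lin tprod_simps op_act_tprod[OF a] tensor_swap_tprod tensor_lift_tprod[OF bil])
  show ?thesis
    by (induction u rule: tensor_induct) (simp_all add: lin gen)
qed

text \<open>Acting by \<open>a\<close> on the second factors turns each representation of
  \<open>tensor_swap u\<close> into one of the swapped image, and every term grows by at most the
  factor \<open>K\<close>.\<close>

lemma proj_PL_norm_op_act_le:
  assumes "PL_norm p" "clinear a" "0 \<le> K" "\<And>\<xi>. norm (a \<xi>) \<le> K * norm \<xi>"
  shows "proj_PL_norm p (op_act a u) \<le> proj_PL_norm p u * K"
  unfolding proj_PL_norm_def
proof (rule le_proj_norm_mult)
  fix n :: nat and x y
  assume u: "tensor_swap u = (\<Sum>i<n. x i \<otimes> y i)"
  note bil = cbilinear_tprod_op_act[OF assms(2)]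
  have "tensor_swap (op_act a u) = (\<Sum>i<n. x i \<otimes> op_act a (y i))"
    by (simp add: tensor_swap_op_act[OF assms(2)] u clinear_sum[OF clinear_tensor_lift[OF bil]]
        tensor_lift_tprod[OF bil])
  then have "proj_norm norm p (tensor_swap (op_act a u)) \<le> (\<Sum>i<n. norm (x i) * p (op_act a (y i)))"
    by (simp only:)
      (rule proj_norm_le_sum[where N = norm and M = p, OF norm_ge_zero PL_norm_nonneg[OF assms(1)]])
  also have "\<dots> \<le> (\<Sum>i<n. norm (x i) * (K * p (y i)))"
    by (intro sum_mono mult_left_mono PL_norm_op_act_le assms) simp
  also have "\<dots> = (\<Sum>i<n. norm (x i) * p (y i)) * K"
    by (simp add: sum_distrib_left mult_ac)
  finally show "proj_norm norm p (tensor_swap (op_act a u)) \<le> (\<Sum>i<n. norm (x i) * p (y i)) * K" .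
qed fact

text \<open>The rank one operator \<open>?a\<close> maps the unit vector \<open>e\<close> to \<xi>
  and has norm at most that of \<xi>, so the bound is a case of the operator estimate. It is the
  \<open>cross\<close> condition on which the natural embedding rests.\<close>

lemma proj_PL_norm_tprod_le:
  fixes p :: "('h::chilbert_space, 'f::complex_vector) tensor \<Rightarrow> real"
  assumes "PL_norm p" "infinite_cdim TYPE('h)"
  shows "proj_PL_norm p (\<xi> \<otimes> w) \<le> norm \<xi> * underlying_norm (proj_PL_norm p) w"
proof -
  \<comment> \<open>The same choice as in \<open>underlying_norm\<close>, so that the final bound
    unfolds to it.\<close>
  define e where "e = (SOME e::'h. norm e = 1)"
  have e: "norm e = 1"
    unfolding e_def by (rule someI_ex) (rule exists_unit_vector[OF assms(2)])
  let ?a = "\<lambda>\<eta>. cinner \<eta> e *\<^sub>C \<xi>"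
  have "?a e = \<xi>" using e by (simp add: cinner_self scaleC_one)
  then have "\<xi> \<otimes> w = op_act ?a (e \<otimes> w)"
    by (simp add: op_act_tprod[OF clinear_rank_one])
  also have "proj_PL_norm p \<dots> \<le> proj_PL_norm p (e \<otimes> w) * norm \<xi>"
  proof (rule proj_PL_norm_op_act_le[OF assms(1) clinear_rank_one])
    show "norm (?a \<eta>) \<le> norm \<xi> * norm \<eta>" for \<eta>
      using mult_right_mono[OF cmod_cinner_unit_le[OF e, of \<eta>], of "norm \<xi>"]
      by (simp add: norm_scaleC mult.commute)
  qed simp
  finally show ?thesis by (simp add: underlying_norm_def e_def mult.commute)
qed


section \<open>The natural embedding of a completion\<close>

lemma bounded_linear_scaleC: "bounded_linear (\<lambda>x::'a::complex_normed_vector. c *\<^sub>C x)"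
  by (rule bounded_linear_intro[where K = "cmod c"])
    (simp_all add: scaleC_add_right scaleR_scaleC scaleC_scaleC norm_scaleC mult.commute)

lemma dense_range_sequence:
  fixes j :: "'e \<Rightarrow> 'c::real_normed_vector"
  assumes "closure (range j) = UNIV"
  obtains xs where "(\<lambda>n. j (xs n)) \<longlonglongrightarrow> x"
proof -
  have "x \<in> closure (range j)" using assms by simp
  then obtain f where f: "\<And>n. f n \<in> range j" "f \<longlonglongrightarrow> x"
    unfolding closure_sequential by blast
  then have "\<exists>y. f n = j y" for n by blast
  then obtain xs where "\<And>n. f n = j (xs n)" by metis
  with f(2) that show thesis by (metis (no_types, lifting) ext)
qed

context
  fixes p :: "('h::chilbert_space, 'e::complex_vector) tensor \<Rightarrow> real"
    and j :: "'e \<Rightarrow> 'c::cbanach" and J :: "('h, 'e) tensor \<Rightarrow> 'd::cbanach"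
  assumes maps: "PL_completion_maps p j J"
    and cross: "\<And>\<xi> w. p (\<xi> \<otimes> w) \<le> norm \<xi> * underlying_norm p w"
begin

lemma clinear_maps: "clinear j" "clinear J" and dense_map: "closure (range j) = UNIV"
  using maps by (auto simp: PL_completion_maps_def completion_map_def)

text \<open>\<open>cross\<close> applied to \<open>v - w\<close> and read through the isometries
  \<open>j\<close> and \<open>J\<close>: tensoring with \<xi> is Lipschitz with constant
  \<open>norm \<xi>\<close>.\<close>

lemma norm_tprod_diff_le: "norm (J (\<xi> \<otimes> v) - J (\<xi> \<otimes> w)) \<le> norm \<xi> * norm (j v - j w)"
  using cross[of \<xi> "v - w"] maps
  by (simp add: PL_completion_maps_def completion_map_def tprod_diff_right
      clinear_simps(3)[OF clinear_maps(1), symmetric]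
      clinear_simps(3)[OF clinear_maps(2), symmetric])

text \<open>Names the function lifted in \<open>natural_embedding\<close>, so that its bilinearity
  can be stated.\<close>

definition embedding_map where
  "embedding_map \<xi> x = (THE z. \<forall>xs. (\<lambda>n. j (xs n)) \<longlonglongrightarrow> x \<longrightarrow> (\<lambda>n. J (\<xi> \<otimes> xs n)) \<longlonglongrightarrow> z)"

text \<open>Justifies the definite description. The Lipschitz bound carries Cauchy sequences to
  Cauchy sequences, and two sequences with the same limit have images that differ by a null
  sequence.\<close>

lemma embedding_map_tendsto:
  assumes "(\<lambda>n. j (xs n)) \<longlonglongrightarrow> x"
  shows "(\<lambda>n. J (\<xi> \<otimes> xs n)) \<longlonglongrightarrow> embedding_map \<xi> x"
proof -
  have dist_le: "dist (J (\<xi> \<otimes> xs m)) (J (\<xi> \<otimes> xs n)) \<le> norm \<xi> * dist (j (xs m)) (j (xs n))" for m n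
    by (simp add: dist_norm norm_tprod_diff_le)
  have "Cauchy (\<lambda>n. J (\<xi> \<otimes> xs n))"
  proof (rule metric_CauchyI)
    fix \<epsilon> :: real assume "\<epsilon> > 0"
    \<comment> \<open>Adding 1 keeps the denominator positive when \<xi> is zero.\<close>
    then have "\<epsilon> / (norm \<xi> + 1) > 0" by (simp add: add_nonneg_pos)
    moreover have "Cauchy (\<lambda>n. j (xs n))" using assms by (rule LIMSEQ_imp_Cauchy)
    ultimately obtain M where
      M: "\<And>m n. m \<ge> M \<Longrightarrow> n \<ge> M \<Longrightarrow> dist (j (xs m)) (j (xs n)) < \<epsilon> / (norm \<xi> + 1)"
      by (meson metric_CauchyD)
    have "dist (J (\<xi> \<otimes> xs m)) (J (\<xi> \<otimes> xs n)) < \<epsilon>" if "m \<ge> M" "n \<ge> M" for m n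
    proof -
      have pos: "norm \<xi> + 1 > 0" by (simp add: add_nonneg_pos)
      note dist_le[of m n]
      also have "norm \<xi> * dist (j (xs m)) (j (xs n)) \<le> (norm \<xi> + 1) * dist (j (xs m)) (j (xs n))"
        by (intro mult_right_mono) simp_all
      also have "\<dots> < \<epsilon>" using M[OF that] pos by (simp add: pos_less_divide_eq mult.commute)
      finally show ?thesis .
    qed
    then show "\<exists>M. \<forall>m\<ge>M. \<forall>n\<ge>M. dist (J (\<xi> \<otimes> xs m)) (J (\<xi> \<otimes> xs n)) < \<epsilon>" by blast
  qed
  then obtain z where z: "(\<lambda>n. J (\<xi> \<otimes> xs n)) \<longlonglongrightarrow> z"
    by (auto simp: Cauchy_convergent_iff convergent_def)
  have "embedding_map \<xi> x = z"
    unfolding embedding_map_def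
  proof (rule the_equality)
    show "\<forall>ys. (\<lambda>n. j (ys n)) \<longlonglongrightarrow> x \<longrightarrow> (\<lambda>n. J (\<xi> \<otimes> ys n)) \<longlonglongrightarrow> z"
    proof (intro allI impI)
      fix ys assume "(\<lambda>n. j (ys n)) \<longlonglongrightarrow> x"
      have "(\<lambda>n. norm \<xi> * norm (j (ys n) - j (xs n))) \<longlonglongrightarrow> 0"
        using tendsto_mult_left[OF tendsto_norm[OF tendsto_diff[OF \<open>(\<lambda>n. j (ys n)) \<longlonglongrightarrow> x\<close> assms]],
            of "norm \<xi>"] by simp
      then have "(\<lambda>n. J (\<xi> \<otimes> ys n) - J (\<xi> \<otimes> xs n)) \<longlonglongrightarrow> 0"
        by (rule Lim_null_comparison[OF always_eventually, rotated])
          (simp add: norm_tprod_diff_le)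
      from tendsto_add[OF this z] show "(\<lambda>n. J (\<xi> \<otimes> ys n)) \<longlonglongrightarrow> z" by simp
    qed
  next
    fix z' assume "\<forall>ys. (\<lambda>n. j (ys n)) \<longlonglongrightarrow> x \<longrightarrow> (\<lambda>n. J (\<xi> \<otimes> ys n)) \<longlonglongrightarrow> z'"
    with assms z show "z' = z" by (blast intro: LIMSEQ_unique)
  qed
  with z show ?thesis by simp
qed

text \<open>Sums and multiples of approximating sequences approximate the sums and multiples of the
  limits; each identity then follows from uniqueness of limits.\<close>

lemma cbilinear_embedding_map: "cbilinear embedding_map"
proof (rule cbilinearI)
  note J = clinear_simps[OF clinear_maps(2)] and j = clinear_simps[OF clinear_maps(1)]
  fix \<xi> \<xi>' :: 'h and x x' :: 'c and c :: complex
  obtain xs xs' where xs: "(\<lambda>n. j (xs n)) \<longlonglongrightarrow> x" and xs': "(\<lambda>n. j (xs' n)) \<longlonglongrightarrow> x'"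
    by (metis dense_range_sequence[OF dense_map])
  note lim = embedding_map_tendsto[OF xs]
  show "embedding_map (\<xi> + \<xi>') x = embedding_map \<xi> x + embedding_map \<xi>' x"
    using lim[of "\<xi> + \<xi>'"] tendsto_add[OF lim[of \<xi>] lim[of \<xi>']]
    by (simp add: tprod_simps J LIMSEQ_unique)
  show "embedding_map (c *\<^sub>C \<xi>) x = c *\<^sub>C embedding_map \<xi> x"
    using lim[of "c *\<^sub>C \<xi>"] bounded_linear.tendsto[OF bounded_linear_scaleC lim[of \<xi>], of c]
    by (simp add: tprod_simps J LIMSEQ_unique)
  have "(\<lambda>n. j (xs n + xs' n)) \<longlonglongrightarrow> x + x'"
    using tendsto_add[OF xs xs'] by (simp add: j)
  from embedding_map_tendsto[OF this, of \<xi>] tendsto_add[OF lim[of \<xi>] embedding_map_tendsto[OF xs']]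
  show "embedding_map \<xi> (x + x') = embedding_map \<xi> x + embedding_map \<xi> x'"
    by (simp add: tprod_simps J LIMSEQ_unique)
  have "(\<lambda>n. j (c *\<^sub>C xs n)) \<longlonglongrightarrow> c *\<^sub>C x"
    using bounded_linear.tendsto[OF bounded_linear_scaleC xs] by (simp add: j)
  from embedding_map_tendsto[OF this, of \<xi>]
    bounded_linear.tendsto[OF bounded_linear_scaleC lim[of \<xi>], of c]
  show "embedding_map \<xi> (c *\<^sub>C x) = c *\<^sub>C embedding_map \<xi> x"
    by (simp add: tprod_simps J LIMSEQ_unique)
qed

lemma natural_embedding_eq: "natural_embedding j J = tensor_lift embedding_map"
  unfolding natural_embedding_def embedding_map_def ..

lemma clinear_natural_embedding: "clinear (natural_embedding j J)"
  unfolding natural_embedding_eq by (rule clinear_tensor_lift[OF cbilinear_embedding_map])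

text \<open>The constant sequence \<open>w\<close> approximates \<open>j w\<close>.\<close>

lemma natural_embedding_tprod: "natural_embedding j J (\<xi> \<otimes> j w) = J (\<xi> \<otimes> w)"
proof -
  have "(\<lambda>n. J (\<xi> \<otimes> w)) \<longlonglongrightarrow> embedding_map \<xi> (j w)"
    by (rule embedding_map_tendsto) simp
  then show ?thesis
    by (simp add: natural_embedding_eq tensor_lift_tprod[OF cbilinear_embedding_map]
        LIMSEQ_const_iff)
qed

end


section \<open>Amplifications\<close>

context
  fixes dia :: "'h::chilbert_space \<Rightarrow> 'h \<Rightarrow> 'h"
    and R :: "'e::complex_vector \<Rightarrow> 'f::complex_vector \<Rightarrow> 'g::complex_vector"
  assumes dia: "cbilinear dia" and R: "cbilinear R"
begin

lemma cbilinear_amplification_inner: "cbilinear (\<lambda>\<eta> y. dia \<xi> \<eta> \<otimes> R x y)"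
  by (rule cbilinearI) (simp_all add: cbilinear_simps[OF dia] cbilinear_simps[OF R] tprod_simps)

lemma cbilinear_amplification_outer:
  "cbilinear (\<lambda>\<xi> x. tensor_lift (\<lambda>\<eta> y. dia \<xi> \<eta> \<otimes> R x y) v)"
  by (rule cbilinearI)
    (simp_all add: cbilinear_simps[OF dia] cbilinear_simps[OF R] tprod_simps
      tensor_lift_fun_add tensor_lift_fun_scale)

lemma clinear_amplification: "clinear (\<lambda>u. amplification dia R u v)"
  unfolding amplification_def by (rule clinear_tensor_lift[OF cbilinear_amplification_outer])

lemma amplification_tprod_left:
  "amplification dia R (\<xi> \<otimes> x) v = tensor_lift (\<lambda>\<eta> y. dia \<xi> \<eta> \<otimes> R x y) v"
  by (simp add: amplification_def tensor_lift_tprod[OF cbilinear_amplification_outer])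

lemma clinear_amplification_tprod: "clinear (amplification dia R (\<xi> \<otimes> x))"
  unfolding amplification_tprod_left by (rule clinear_tensor_lift[OF cbilinear_amplification_inner])

lemma amplification_tprod:
  "amplification dia R (\<xi> \<otimes> x) (\<eta> \<otimes> y) = dia \<xi> \<eta> \<otimes> R x y"
  by (simp add: amplification_tprod_left tensor_lift_tprod[OF cbilinear_amplification_inner])

end

text \<open>For fixed \<xi>, \<open>dia \<xi>\<close> is a linear operator on H; both sides are
  linear in \<open>v\<close> and agree on elementary tensors.\<close>

lemma tensor_swap_amplification_tprod:
  assumes dia: "cbilinear dia"
  shows "tensor_swap (amplification dia (\<otimes>) (\<xi> \<otimes> x) v) = x \<otimes> op_act (dia \<xi>) v"
proof -
  have a: "clinear (dia \<xi>)" using dia by (simp add: cbilinear_def)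
  note lin = clinear_simps[OF clinear_tensor_swap] clinear_simps[OF clinear_op_act[OF a]]
    clinear_simps[OF clinear_amplification_tprod[OF dia cbilinear_tprod]]
  show ?thesis
    by (induction v rule: tensor_induct)
      (simp_all add: lin tprod_simps op_act_tprod[OF a] tensor_swap_tprod
        amplification_tprod[OF dia cbilinear_tprod])
qed

text \<open>Only \<open>u\<close> is decomposed, while \<open>v\<close> is kept whole, so that the
  module estimate for \<open>p\<close> applies to each term.\<close>

lemma proj_PL_norm_amplification_le:
  assumes dia: "cbilinear dia" and le: "\<And>\<xi> \<eta>. norm (dia \<xi> \<eta>) \<le> norm \<xi> * norm \<eta>"
    and p: "PL_norm p"
  shows "proj_PL_norm p (amplification dia (\<otimes>) u v) \<le> max_PL_norm u * p v"
  unfolding proj_PL_norm_def max_PL_norm_def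
proof (rule le_proj_norm_mult)
  fix n :: nat and \<xi> x
  assume u: "u = (\<Sum>i<n. \<xi> i \<otimes> x i)"
  have "tensor_swap (amplification dia (\<otimes>) u v) = (\<Sum>i<n. x i \<otimes> op_act (dia (\<xi> i)) v)"
    by (simp add: u clinear_sum[OF clinear_amplification[OF dia cbilinear_tprod]]
        clinear_sum[OF clinear_tensor_swap] tensor_swap_amplification_tprod[OF dia])
  then have "proj_norm norm p (tensor_swap (amplification dia (\<otimes>) u v))
      \<le> (\<Sum>i<n. norm (x i) * p (op_act (dia (\<xi> i)) v))"
    by (simp only:)
      (rule proj_norm_le_sum[where N = norm and M = p, OF norm_ge_zero PL_norm_nonneg[OF p]])
  also have "\<dots> \<le> (\<Sum>i<n. norm (x i) * (norm (\<xi> i) * p v))"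
    using dia by (intro sum_mono mult_left_mono PL_norm_op_act_le p le) (simp_all add: cbilinear_def)
  also have "\<dots> = (\<Sum>i<n. norm (\<xi> i) * norm (x i)) * p v"
    by (simp add: sum_distrib_left mult_ac)
  finally show "proj_norm norm p (tensor_swap (amplification dia (\<otimes>) u v))
      \<le> (\<Sum>i<n. norm (\<xi> i) * norm (x i)) * p v" .
qed (rule PL_norm_nonneg[OF p])

text \<open>Composing \<open>R\<close> with \<open>j\<close> and then embedding has the same effect
  as applying \<open>J\<close> to the amplification of \<open>R\<close>. As \<open>J\<close> is
  isometric, this reduces the completed range to the uncompleted one. Linearity reduces the identity
  to elementary tensors, where it is \<open>natural_embedding_tprod\<close>.\<close>

lemma natural_embedding_amplification:
  assumes dia: "cbilinear dia" and R: "cbilinear R"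
    and maps: "PL_completion_maps p j J"
    and cross: "\<And>\<xi> w. p (\<xi> \<otimes> w) \<le> norm \<xi> * underlying_norm p w"
  shows "natural_embedding j J (amplification dia (\<lambda>x y. j (R x y)) u v) =
    J (amplification dia R u v)"
proof -
  note lin_j = clinear_maps(1)[OF maps cross] and lin_J = clinear_maps(2)[OF maps cross]
  have jR: "cbilinear (\<lambda>x y. j (R x y))"
    by (rule cbilinearI) (simp_all add: cbilinear_simps[OF R] clinear_simps[OF lin_j])
  note lin = clinear_simps[OF lin_J] clinear_simps[OF clinear_natural_embedding[OF maps cross]]
    clinear_simps[OF clinear_amplification[OF dia R]]
    clinear_simps[OF clinear_amplification[OF dia jR]]
    clinear_simps[OF clinear_amplification_tprod[OF dia R]]
    clinear_simps[OF clinear_amplification_tprod[OF dia jR]]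
  have gen: "natural_embedding j J (amplification dia (\<lambda>x y. j (R x y)) (\<xi> \<otimes> x) v) =
      J (amplification dia R (\<xi> \<otimes> x) v)" for \<xi> x
    by (induction v rule: tensor_induct)
      (simp_all add: lin amplification_tprod[OF dia R] amplification_tprod[OF dia jR]
        natural_embedding_tprod[OF maps cross])
  show ?thesis
    by (induction u rule: tensor_induct) (simp_all add: lin gen)
qed

section \<open>The product on H induced by the Hilbert tensor product\<close>

lemma cbilinear_diamond:
  assumes "hilbert_tensor_map t" "unitary_iso \<iota>"
  shows "cbilinear (diamond t \<iota>)"
proof -
  have "clinear t" "clinear \<iota>"
    using assms by (auto simp: hilbert_tensor_map_def unitary_iso_def)
  then show ?thesis
    by (intro cbilinearI) (simp_all add: diamond_def clinear_simps tprod_simps)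
qed

text \<open>The inner product on elementary tensors is a product of inner products and
  \<open>\<iota>\<close> preserves it; taking equal arguments gives the squared norms.\<close>

lemma norm_diamond:
  assumes "hilbert_tensor_map t" "unitary_iso \<iota>"
  shows "norm (diamond t \<iota> \<xi> \<eta>) = norm \<xi> * norm \<eta>"
proof -
  have "complex_of_real ((norm (diamond t \<iota> \<xi> \<eta>))\<^sup>2) = cinner \<xi> \<xi> * cinner \<eta> \<eta>"
    using assms unfolding cinner_self[symmetric]
    by (simp add: diamond_def hilbert_tensor_map_def unitary_iso_def)
  also have "\<dots> = complex_of_real ((norm \<xi> * norm \<eta>)\<^sup>2)"
    by (simp add: cinner_self power_mult_distrib)
  finally show ?thesis
    by (simp only: of_real_eq_iff) (simp add: power2_eq_iff_nonneg)
qed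

theorem proposition3p7:
  fixes t :: "('h::chilbert_space, 'h) tensor \<Rightarrow> 'k::chilbert_space"
    and \<iota> :: "'k \<Rightarrow> 'h"
    and p :: "('h, 'f::complex_vector) tensor \<Rightarrow> real"
  assumes "separable_space (euclidean :: 'h topology)"
    and "infinite_cdim TYPE('h)"
    and "hilbert_tensor_map t"
    and "unitary_iso \<iota>"
    and "PL_norm p"
  shows "L_contractive (diamond t \<iota>) max_PL_norm p (proj_PL_norm p)
           (\<lambda>(x::'e::complex_normed_vector) y. x \<otimes> y) \<and>
         (\<forall>(j :: ('e, 'f) tensor \<Rightarrow> 'c::cbanach)
           (J :: ('h, ('e, 'f) tensor) tensor \<Rightarrow> 'd::cbanach).
           PL_completion_maps (proj_PL_norm p) j J \<longrightarrow>
           L_contractive (diamond t \<iota>) max_PL_norm p (completion_PL_norm j J)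
             (\<lambda>x y. j (x \<otimes> y)))"
proof -
  note dia = cbilinear_diamond[OF assms(3,4)]
  have le: "proj_PL_norm p (amplification (diamond t \<iota>) (\<otimes>) u v) \<le> max_PL_norm u * p v"
    for u :: "('h, 'e) tensor" and v
    by (rule proj_PL_norm_amplification_le[OF dia _ assms(5)]) (simp add: norm_diamond assms(3,4))
  have "L_contractive (diamond t \<iota>) max_PL_norm p (completion_PL_norm j J)
      (\<lambda>(x::'e) y. j (x \<otimes> y))"
    if maps: "PL_completion_maps (proj_PL_norm p) j J"
    for j :: "('e, 'f) tensor \<Rightarrow> 'c" and J :: "('h, ('e, 'f) tensor) tensor \<Rightarrow> 'd"
  proof -
    have j: "clinear j" and J: "\<And>u. norm (J u) = proj_PL_norm p u"
      using maps by (auto simp: PL_completion_maps_def completion_map_def)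
    have "cbilinear (\<lambda>(x::'e) y. j (x \<otimes> y))"
      by (rule cbilinearI) (simp_all add: tprod_simps clinear_simps[OF j])
    \<comment> \<open>Rewrites the completed norm of the amplification as \<open>norm (J u)\<close>
      for the uncompleted one \<open>u\<close>, which is its \<open>proj_PL_norm\<close>, so
      \<open>le\<close> applies.\<close>
    moreover note natural_embedding_amplification[OF dia cbilinear_tprod maps
        proj_PL_norm_tprod_le[OF assms(5,2)]]
    ultimately show ?thesis
      by (simp add: L_contractive_def completion_PL_norm_def J le)
  qed
  then show ?thesis
    using le by (simp add: L_contractive_def cbilinear_tprod)
qed

end
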